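(* Let $S\subset\mathbb{R}^3$ be a finite set with $\mathcal{D}_{2m+1}\subseteq\operatorname{Sym}(S)$ for some integer $m\ge 2$. If $a(S)=4$ and $g(G_S)=3$, then $G_S$ contains a topological wheel graph $W_{2m+2}$ as a subgraph.
   Context: For a set $S\subset\mathbb{R}^n$ of diameter $d>0$, the Borsuk number $a(S)$ is the smallest $m$ such that $S$ can be covered by (equivalently, partitioned into) $m$ sets of diameters strictly less than $d$. $\operatorname{Sym}(S)$ denotes the symmetry group of $S$, i.e. the group of isometries of $\mathbb{R}^3$ mapping $S$ onto itself. $\mathcal{D}_k$ denotes the symmetry group of a regular $k$-gon, acting on $\mathbb{R}^3$ as the group of order $2k$ consisting of the rotations about an axis $L$ by multiples of $2\pi/k$ and the reflections about $k$ planes containing $L$; $\mathcal{D}_k\subseteq\operatorname{Sym}(S)$ means that $\operatorname{Sym}(S)$ contains such a group. The diameter graph $G_S$ of a finite set $S$ is the graph with vertex set $S$ in which two points are joined by an edge if and only if their distance equals the diameter of $S$. The girth $g(G)$ of a graph is the length of its shortest cycle. The wheel graph $W_{2m+2}$ consists of a cycle of length $2m+1$ together with one additional vertex joined to all vertices of the cycle. A topological $W_{2m+2}$ is a subdivision of $W_{2m+2}$, i.e. a graph obtained from it by replacing edges by internally disjoint paths. *)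

theory Defs
  imports
    "HOL-Analysis.Analysis"
    "HOL-Library.Extended_Nat"
    "Graph_Theory.Graph_Theory"
begin

(* The pieces are required to be bounded because diameter has no meaningful value on
   unbounded sets. The value is \<infinity> exactly when there is no admissible finite
   covering, e.g. for a singleton S. *)
definition borsuk_number :: "'a::metric_space set \<Rightarrow> enat" where
  "borsuk_number S =
     Inf {enat (card F) | F. finite F \<and> S \<subseteq> \<Union>F \<and>
            (\<forall>A\<in>F. bounded A \<and> diameter A < diameter S)}"

definition Sym :: "'a::metric_space set \<Rightarrow> ('a \<Rightarrow> 'a) set" where
  "Sym S = {f. surj f \<and> (\<forall>x y. dist (f x) (f y) = dist x y) \<and> f ` S = S}"

definition orthonormal_frame :: "real^3 \<Rightarrow> real^3 \<Rightarrow> real^3 \<Rightarrow> bool" where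
  "orthonormal_frame u v w \<longleftrightarrow>
     norm u = 1 \<and> norm v = 1 \<and> norm w = 1 \<and>
     orthogonal u v \<and> orthogonal u w \<and> orthogonal v w"

(* Rotation by the angle t about the line through p with direction w, where (u, v, w) is
   an orthonormal frame. *)
definition axis_rotation ::
  "real^3 \<Rightarrow> real^3 \<Rightarrow> real^3 \<Rightarrow> real^3 \<Rightarrow> real \<Rightarrow> real^3 \<Rightarrow> real^3" where
  "axis_rotation p u v w t x =
     p + (cos t * ((x - p) \<bullet> u) - sin t * ((x - p) \<bullet> v)) *\<^sub>R u
       + (sin t * ((x - p) \<bullet> u) + cos t * ((x - p) \<bullet> v)) *\<^sub>R v
       + ((x - p) \<bullet> w) *\<^sub>R w"

(* Reflection in the plane through p with directions w and cos t u + sin t v, where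
   (u, v, w) is an orthonormal frame; n is a unit normal of this plane. *)
definition axis_reflection ::
  "real^3 \<Rightarrow> real^3 \<Rightarrow> real^3 \<Rightarrow> real \<Rightarrow> real^3 \<Rightarrow> real^3" where
  "axis_reflection p u v t x =
     (let n = cos t *\<^sub>R v - sin t *\<^sub>R u in x - (2 * ((x - p) \<bullet> n)) *\<^sub>R n)"

(* The axis is L = {p + s w | s}. The maps are the symmetries that the regular k-gon with
   vertices p + cos (2 pi j / k) u + sin (2 pi j / k) v has among the isometries fixing L
   pointwise; its k mirror planes contain L and are spaced at angles pi / k, starting with
   the one through the vertex p + u. *)
definition dihedral_group :: "nat \<Rightarrow> (real^3 \<Rightarrow> real^3) set \<Rightarrow> bool" where
  "dihedral_group k D \<longleftrightarrow>
     (\<exists>p u v w. orthonormal_frame u v w \<and>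
        D = {axis_rotation p u v w (2 * pi * real j / real k) | j. j < k} \<union>
            {axis_reflection p u v (pi * real j / real k) | j. j < k})"

(* Undirected simple graphs are represented, as in Graph_Theory, by symmetric loop-free
   digraphs with both orientations of every edge. *)
definition diameter_graph :: "'a::metric_space set \<Rightarrow> 'a pair_pre_digraph" where
  "diameter_graph S =
     \<lparr>pverts = S,
      parcs = {(x, y). x \<in> S \<and> y \<in> S \<and> x \<noteq> y \<and> dist x y = diameter S}\<rparr>"

(* The bound 3 excludes the closed walks u, v, u, which count as cycles in a symmetric
   digraph. The value is \<infinity> for a graph without cycles. *)
definition girth :: "('a, 'b) pre_digraph \<Rightarrow> enat" where
  "girth G = Inf {enat (length p) | p. pre_digraph.cycle G p \<and> 3 \<le> length p}"

(* n is the total number of vertices: a rim cycle c 0, ..., c (n - 2) and a hub h. *)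
definition wheel_graph :: "nat \<Rightarrow> 'a pair_pre_digraph \<Rightarrow> bool" where
  "wheel_graph n W \<longleftrightarrow>
     4 \<le> n \<and>
     (\<exists>h c. inj_on c {..<n - 1} \<and> h \<notin> c ` {..<n - 1} \<and>
        pverts W = insert h (c ` {..<n - 1}) \<and>
        parcs W = (\<Union>i<n - 1. {(c i, c (Suc i mod (n - 1))), (c (Suc i mod (n - 1)), c i),
                               (h, c i), (c i, h)}))"

definition topological_wheel_graph :: "nat \<Rightarrow> 'a pair_pre_digraph \<Rightarrow> bool" where
  "topological_wheel_graph n H \<longleftrightarrow> (\<exists>W. wheel_graph n W \<and> subdivision_pair W H)"

end

theory Submission
  imports Defs "HOL-Number_Theory.Cong"
begin

text \<open>
  Write \<open>k = 2 * m + 1\<close>, and call a triangle of the diameter graph simply a triangle. The proof rests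
  on the fact, a case of a theorem of Dol'nikov, that a triangle and an odd cycle of the diameter
  graph of a set in space always share a vertex (\<open>triangle_meets_odd_closed_walk\<close>).

  Girth 3 provides a triangle. It shares a vertex with its image under the rotation by \<open>2 * pi / k\<close>, and
  comparing chords of the regular \<open>k\<close>-gons that are the orbits off the axis shows that such a vertex can
  only arise from a vertex on the axis (\<open>triangle_meets_axis\<close>). The triangle has exactly one
  vertex \<open>h\<close> there (\<open>triangle_meets_axis_once\<close>), so all rotations fix \<open>h\<close> and move the other two vertices
  \<open>b\<close> and \<open>c\<close>, and all rotated copies of \<open>b\<close> and \<open>c\<close> are neighbours of \<open>h\<close>.

  If \<open>b\<close> and \<open>c\<close> belong to the same orbit, then the longest diagonals of that orbit are edges; they form a
  cycle of length \<open>k\<close> all of whose vertices are neighbours of \<open>h\<close> (\<open>wheel_of_diagonals\<close>). Otherwise the \<open>k\<close>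
  copies of the triangle have only \<open>h\<close> in common. As the Borsuk number is 4, the diameter graph without
  \<open>h\<close> is not bipartite and contains an odd cycle, which meets every copy of the triangle, and so
  contains \<open>k\<close> different neighbours of \<open>h\<close> (\<open>wheel_of_odd_cycle\<close>). In both cases the cycle and \<open>h\<close>
  with \<open>k\<close> spokes form a subdivided wheel.
\<close>

section \<open>Triangles and odd closed walks in diameter graphs\<close>

text \<open>
  The bound \<open>dist s b \<le> d\<close> with its quadratic terms moved to one side. What remains is linear in the
  direction \<open>b - a\<close> and so passes to the cone spanned by two such directions (next lemma). The cones
  spanned by the directions to two neighbours of a vertex are what the intersection theorem is about.
\<close>

lemma inner_ge_half_dist_squared:
  fixes a b s :: "'a::real_inner"
  assumes "dist a b = d" "dist s b \<le> d"
  shows "(s - a) \<bullet> (b - a) \<ge> (norm (s - a))\<^sup>2 / 2"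
proof -
  have "(norm (s - b))\<^sup>2 \<le> d\<^sup>2"
    using assms(2) by (intro power_mono) (auto simp: dist_norm)
  moreover have "(norm (b - a))\<^sup>2 = d\<^sup>2"
    using assms(1) by (simp add: dist_norm norm_minus_commute)
  moreover have "(norm (s - b))\<^sup>2 = (norm (s - a))\<^sup>2 + (norm (b - a))\<^sup>2 - 2 * ((s - a) \<bullet> (b - a))"
    by (simp add: power2_norm_eq_inner algebra_simps inner_commute)
  ultimately show ?thesis by linarith
qed

lemma inner_cone_ge:
  fixes a b c s :: "'a::real_inner"
  assumes "dist a b = d" "dist a c = d" "dist s b \<le> d" "dist s c \<le> d" "l \<ge> 0" "k \<ge> 0"
  shows "(s - a) \<bullet> (l *\<^sub>R (b - a) + k *\<^sub>R (c - a)) \<ge> (l + k) * (norm (s - a))\<^sup>2 / 2"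
proof -
  have "l * ((s - a) \<bullet> (b - a)) \<ge> l * ((norm (s - a))\<^sup>2 / 2)"
    "k * ((s - a) \<bullet> (c - a)) \<ge> k * ((norm (s - a))\<^sup>2 / 2)"
    using assms by (intro mult_left_mono inner_ge_half_dist_squared[where d = d]; simp)+
  then show ?thesis by (simp add: inner_add_right algebra_simps add_divide_distrib)
qed

text \<open>
  The cone at \<open>a\<close> lies strictly on the side of \<open>v\<close> (it makes positive inner products with \<open>v - a\<close>), the
  cone at \<open>v\<close> on the side of \<open>a\<close>, so they have no common direction unless \<open>a = v\<close>.
\<close>

lemma neighbour_cones_disjoint:
  fixes a b c v p q :: "'a::real_inner"
  assumes "dist a b = d" "dist a c = d" "dist v p = d" "dist v q = d"
    and "dist v b \<le> d" "dist v c \<le> d" "dist a p \<le> d" "dist a q \<le> d"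
    and nn: "l \<ge> 0" "k \<ge> 0" "l + k > 0" "l' \<ge> 0" "k' \<ge> 0"
    and eq: "l *\<^sub>R (b - a) + k *\<^sub>R (c - a) = l' *\<^sub>R (p - v) + k' *\<^sub>R (q - v)"
  shows "v = a"
proof (rule ccontr)
  assume "v \<noteq> a"
  then have pos: "(norm (v - a))\<^sup>2 > 0" by simp
  have "(v - a) \<bullet> (l *\<^sub>R (b - a) + k *\<^sub>R (c - a)) \<ge> (l + k) * (norm (v - a))\<^sup>2 / 2"
    using assms by (intro inner_cone_ge) auto
  moreover have "(l + k) * (norm (v - a))\<^sup>2 / 2 > 0"
    using pos nn by simp
  moreover have "(a - v) \<bullet> (l' *\<^sub>R (p - v) + k' *\<^sub>R (q - v)) \<ge> (l' + k') * (norm (a - v))\<^sup>2 / 2"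
    using assms by (intro inner_cone_ge) auto
  moreover have "(l' + k') * (norm (a - v))\<^sup>2 / 2 \<ge> 0"
    using nn by simp
  moreover have "(a - v) \<bullet> (l' *\<^sub>R (p - v) + k' *\<^sub>R (q - v)) 
      = - ((v - a) \<bullet> (l *\<^sub>R (b - a) + k *\<^sub>R (c - a)))"
    unfolding eq by (simp add: inner_diff_left)
  ultimately show False by linarith
qed

text \<open>
  Let \<open>z\<close> be a vector of length \<open>d\<close> in the cone at \<open>a\<close> such that \<open>- z\<close> lies in the cone at \<open>v\<close>. A point
  within \<open>d\<close> of \<open>a\<close>, \<open>b\<close> and \<open>c\<close> is within \<open>d\<close> of the whole arc of radius \<open>d\<close> about \<open>a\<close> from \<open>b\<close> to \<open>c\<close>,
  so adding arcs to a set of diameter \<open>d\<close> does not enlarge the diameter. Hence \<open>a + z\<close> and \<open>v - z\<close>, which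
  are on the arcs at \<open>a\<close> and at \<open>v\<close>, have distance at most \<open>d\<close>. In the parallelogram \<open>a\<close>, \<open>a + z\<close>,
  \<open>v\<close>, \<open>v - z\<close> both diagonals are thus at most \<open>d\<close>, while one pair of sides has length \<open>d\<close>; by the
  parallelogram law the other sides vanish, \<open>v = a + z\<close>. So \<open>v\<close> lies on the arc at \<open>a\<close>. Inside the
  arc, the distance \<open>d\<close> is attained only from the centre \<open>a\<close>; as \<open>p\<close> is at distance \<open>d\<close> from \<open>v\<close>,
  either \<open>v\<close> is an endpoint of the arc or \<open>p = a\<close>.
\<close>

lemma opposite_cones_meet_in_edge:
  fixes a b c v p q :: "'a::real_inner"
  assumes d: "d > 0"
    and nb: "dist a b = d" "dist a c = d" "dist b c = d" "dist v p = d" "dist v q = d"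
    and le: "dist v a \<le> d" "dist p b \<le> d" "dist p c \<le> d" "dist q b \<le> d" "dist q c \<le> d"
    and nn: "l \<ge> 0" "k \<ge> 0" "l + k > 0" "l' \<ge> 0" "k' \<ge> 0"
    and eq: "l *\<^sub>R (b - a) + k *\<^sub>R (c - a) = - (l' *\<^sub>R (p - v) + k' *\<^sub>R (q - v))"
  shows "v = b \<or> v = c \<or> p = a"
proof -
  have ip: "(b - a) \<bullet> (c - a) = d\<^sup>2 / 2" and ib: "(b - a) \<bullet> (b - a) = d\<^sup>2"
    and ic: "(c - a) \<bullet> (c - a) = d\<^sup>2"
  proof -
    show ib: "(b - a) \<bullet> (b - a) = d\<^sup>2" and ic: "(c - a) \<bullet> (c - a) = d\<^sup>2"
      using nb by (simp_all add: dist_norm norm_minus_commute flip: power2_norm_eq_inner)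
    have "(b - c) \<bullet> (b - c) = d\<^sup>2"
      using nb by (simp add: dist_norm flip: power2_norm_eq_inner)
    moreover have "(b - c) \<bullet> (b - c)
        = (b - a) \<bullet> (b - a) + (c - a) \<bullet> (c - a) - 2 * ((b - a) \<bullet> (c - a))"
      by (simp add: algebra_simps inner_commute)
    ultimately show "(b - a) \<bullet> (c - a) = d\<^sup>2 / 2" using ib ic by simp
  qed
  have quad: "(norm (l *\<^sub>R (b - a) + k *\<^sub>R (c - a)))\<^sup>2 = d\<^sup>2 * (l\<^sup>2 + k\<^sup>2 + l * k)" for l k
  proof -
    have "(norm (l *\<^sub>R (b - a) + k *\<^sub>R (c - a)))\<^sup>2
        = l\<^sup>2 * ((b - a) \<bullet> (b - a)) + k\<^sup>2 * ((c - a) \<bullet> (c - a)) + 2 * l * k * ((b - a) \<bullet> (c - a))"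
      unfolding power2_norm_eq_inner inner_add_left inner_add_right inner_scaleR_left
        inner_scaleR_right inner_commute[of "c - a" "b - a"] 
      by (simp add: power2_eq_square distrib_left)
    then show ?thesis unfolding ip ib ic by (simp add: algebra_simps)
  qed
  \<comment> \<open>The length of the common vector is \<open>r * d\<close>; rescaling by \<open>r\<close> gives it length \<open>d\<close>.\<close>
  define r where "r = sqrt (l\<^sup>2 + k\<^sup>2 + l * k)"
  have "l\<^sup>2 + k\<^sup>2 + l * k > 0"
  proof (cases "l = 0")
    case True
    then show ?thesis using nn by simp
  next
    case False
    then have "l\<^sup>2 > 0" by simp
    then show ?thesis using nn by (simp add: add_pos_nonneg)
  qed
  then have r: "r > 0" "r\<^sup>2 = l\<^sup>2 + k\<^sup>2 + l * k" by (simp_all add: r_def)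
  define L K L' K' where "L = l / r" and "K = k / r" and "L' = l' / r" and "K' = k' / r"
  have NN: "L \<ge> 0" "K \<ge> 0" "L' \<ge> 0" "K' \<ge> 0" 
    using nn r by (simp_all add: L_def K_def L'_def K'_def)
  have LK: "L\<^sup>2 + K\<^sup>2 + L * K = 1"
  proof -
    have "L\<^sup>2 + K\<^sup>2 + L * K = (l\<^sup>2 + k\<^sup>2 + l * k) / r\<^sup>2"
      by (simp add: L_def K_def power2_eq_square add_divide_distrib)
    then show ?thesis using r by (metis divide_self less_irrefl zero_less_power)
  qed
  define z where "z = L *\<^sub>R (b - a) + K *\<^sub>R (c - a)"
  have z': "- z = L' *\<^sub>R (p - v) + K' *\<^sub>R (q - v)"
  proof -
    have "z = (1 / r) *\<^sub>R (l *\<^sub>R (b - a) + k *\<^sub>R (c - a))"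
      by (simp add: z_def L_def K_def scaleR_add_right divide_inverse mult.commute
          del: scaleR_diff_right)
    also have "\<dots> = - (L' *\<^sub>R (p - v) + K' *\<^sub>R (q - v))"
      unfolding eq by (simp add: L'_def K'_def scaleR_add_right divide_inverse mult.commute
          scaleR_diff_right)
    finally show ?thesis by simp
  qed
  have zz: "(norm z)\<^sup>2 = d\<^sup>2" unfolding z_def quad LK by simp
  have zd: "norm z = d" using zz d by (simp add: power2_eq_iff_nonneg)
  have "(L + K)\<^sup>2 = (L\<^sup>2 + K\<^sup>2 + L * K) + L * K" by (simp add: power2_sum)
  then have square: "(L + K)\<^sup>2 = 1 + L * K" unfolding LK .
  have sumLK: "L + K \<ge> 1"
  proof -
    have "L * K \<ge> 0" using NN by simp
    then have "(L + K)\<^sup>2 \<ge> 1\<^sup>2" using square by simp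
    then show ?thesis by (rule power2_le_imp_le) (use NN in simp)
  qed
  have sumLK': "L' + K' \<ge> 1"
  proof -
    have "norm (L' *\<^sub>R (p - v) + K' *\<^sub>R (q - v)) \<le> L' * d + K' * d"
      using NN nb by (intro norm_triangle_le) (simp add: dist_norm norm_minus_commute)
    then have "d \<le> (L' + K') * d" using zd z' by (metis norm_minus_cancel distrib_right)
    then show ?thesis using d by simp
  qed
  have red: "(s - a) \<bullet> z \<ge> (L + K) * (norm (s - a))\<^sup>2 / 2" if "dist s b \<le> d" "dist s c \<le> d" for s
    unfolding z_def using that NN nb by (intro inner_cone_ge) auto
  have tip: "dist (a + z) s \<le> d" if "dist s b \<le> d" "dist s c \<le> d" for s
  proof -
    have "(norm (s - a))\<^sup>2 \<le> (L + K) * (norm (s - a))\<^sup>2"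
      using mult_right_mono[OF sumLK, of "(norm (s - a))\<^sup>2"] by simp
    then have "(norm (s - a))\<^sup>2 \<le> 2 * ((s - a) \<bullet> z)"
      using red[OF that] by linarith
    moreover have "(norm (a + z - s))\<^sup>2 = (norm (s - a))\<^sup>2 - 2 * ((s - a) \<bullet> z) + (norm z)\<^sup>2"
      by (simp add: power2_norm_eq_inner algebra_simps inner_commute)
    ultimately have "(norm (a + z - s))\<^sup>2 \<le> d\<^sup>2" using zz by simp
    then show ?thesis using d by (simp add: dist_norm)
  qed
  \<comment> \<open>The points \<open>a + z\<close> and \<open>v - z\<close> have distance at most \<open>d\<close>; the next facts combine this with the
      parallelogram law.\<close>
  have "(a + z - v) \<bullet> (- z) \<ge> (L' + K') * (norm (a + z - v))\<^sup>2 / 2"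
    unfolding z' using NN nb tip[OF le(2,3)] tip[OF le(4,5)] by (intro inner_cone_ge) auto
  moreover have "(norm (a + z - v))\<^sup>2 \<le> (L' + K') * (norm (a + z - v))\<^sup>2"
    using mult_right_mono[OF sumLK', of "(norm (a + z - v))\<^sup>2"] by simp
  moreover have "(norm (a - v))\<^sup>2 \<le> d\<^sup>2"
    using le d by (intro power_mono) (auto simp: dist_norm norm_minus_commute)
  moreover have "(norm (a + z - v))\<^sup>2 = (norm (a - v))\<^sup>2 + 2 * ((a - v) \<bullet> z) + (norm z)\<^sup>2"
    by (simp add: power2_norm_eq_inner algebra_simps inner_commute)
  moreover have "(a + z - v) \<bullet> (- z) = - ((a - v) \<bullet> z) - (norm z)\<^sup>2"
    by (simp add: power2_norm_eq_inner algebra_simps)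
  ultimately have "(norm (a + z - v))\<^sup>2 \<le> 0" using zz by linarith
  then have v: "v = a + z" by simp
  show ?thesis
  proof (cases "L = 0 \<or> K = 0")
    case True
    then have "(L = 0 \<and> K = 1) \<or> (L = 1 \<and> K = 0)"
      using LK NN by (auto simp: power2_eq_1_iff)
    then show ?thesis by (auto simp: v z_def)
  next
    case False
    then have "L * K > 0" using NN by simp
    \<comment> \<open>Strict convexity: an interior point of the arc has coordinate sum above 1.\<close>
    then have "(L + K)\<^sup>2 > 1\<^sup>2" using square by simp
    then have gt: "L + K > 1" by (rule power2_less_imp_less) (use NN in simp)
    have "(norm (p - a))\<^sup>2 = 2 * ((p - a) \<bullet> z)"
    proof -
      have "(norm (v - p))\<^sup>2 = (norm (p - a))\<^sup>2 - 2 * ((p - a) \<bullet> z) + (norm z)\<^sup>2"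
        unfolding v by (simp add: power2_norm_eq_inner algebra_simps inner_commute)
      then show ?thesis using zz nb by (simp add: dist_norm)
    qed
    moreover have "(p - a) \<bullet> z \<ge> (L + K) * (norm (p - a))\<^sup>2 / 2"
      using le by (intro red)
    ultimately have "(L + K) * (norm (p - a))\<^sup>2 \<le> 1 * (norm (p - a))\<^sup>2" by simp
    then have "(norm (p - a))\<^sup>2 = 0"
      using gt mult_le_cancel_right[of "L + K" "(norm (p - a))\<^sup>2" 1]
      by (simp add: not_le)
    then show ?thesis by simp
  qed
qed

text \<open>
  Expansion of \<open>w\<close> in the basis \<open>x\<close>, \<open>y\<close>, \<open>x \<times> y\<close>; the first two coefficients come from inverting the
  Gram matrix, whose determinant is \<open>N\<close>.
\<close>

lemma orthogonal_cross3_imp_combination: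
  fixes x y w :: "real^3"
  assumes "cross3 x y \<noteq> 0" "w \<bullet> cross3 x y = 0"
  obtains l k where "w = l *\<^sub>R x + k *\<^sub>R y"
proof -
  define N where "N = cross3 x y \<bullet> cross3 x y"
  have N: "N \<noteq> 0" using assms by (simp add: N_def)
  have "N *\<^sub>R w = (w \<bullet> cross3 x y) *\<^sub>R cross3 x y
      + ((y \<bullet> y) * (x \<bullet> w) - (x \<bullet> y) * (y \<bullet> w)) *\<^sub>R x
      + ((x \<bullet> x) * (y \<bullet> w) - (x \<bullet> y) * (x \<bullet> w)) *\<^sub>R y"
    unfolding N_def
    by (simp add: vec_eq_iff forall_3 inner_vec_def sum_3 cross3_def) algebra
  then have e: "N *\<^sub>R w = ((y \<bullet> y) * (x \<bullet> w) - (x \<bullet> y) * (y \<bullet> w)) *\<^sub>R x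
      + ((x \<bullet> x) * (y \<bullet> w) - (x \<bullet> y) * (x \<bullet> w)) *\<^sub>R y"
    using assms by simp
  have "w = inverse N *\<^sub>R (N *\<^sub>R w)" using N by simp
  then show ?thesis unfolding e scaleR_add_right scaleR_scaleR by (rule that)
qed

text \<open>
  The case of Dol'nikov's theorem (two odd cycles of a diameter graph in space share a vertex) in
  which one cycle is a triangle. Seen from the plane of the triangle, the steps of a closed walk of
  odd length cannot alternate strictly between up and down. So some vertex \<open>v\<close> of the walk has its
  two neighbours \<open>p\<close>, \<open>q\<close> weakly on different sides of the plane through \<open>v\<close> parallel to the triangle,
  and the cone of \<open>v\<close> contains a direction \<open>w\<close> of that plane. The cones at \<open>a\<close>, \<open>b\<close>, \<open>c\<close> and their
  negatives are the six sectors of 60 degrees that cover the plane, so \<open>w\<close> is in one of them, and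
  the two lemmas on cones make the walk meet the triangle.
\<close>

lemma triangle_meets_odd_closed_walk:
  fixes a b c :: "real^3" and F :: "nat \<Rightarrow> real^3"
  assumes d: "d > 0"
    and S: "\<And>x y. x \<in> S \<Longrightarrow> y \<in> S \<Longrightarrow> dist x y \<le> d"
    and T: "a \<in> S" "b \<in> S" "c \<in> S" "dist a b = d" "dist a c = d" "dist b c = d"
    and F: "\<And>j. F j \<in> S" "\<And>j. dist (F j) (F (Suc j)) = d"
    and N: "odd N" "\<And>j. F (j + N) = F j"
  shows "\<exists>j. F j \<in> {a, b, c}"
proof (rule ccontr)
  assume "\<not> ?thesis"
  then have avoid: "F j \<noteq> a" "F j \<noteq> b" "F j \<noteq> c" for j by auto
  define n where "n = cross3 (b - a) (c - a)"
  define g where "g j = (F (Suc j) - F j) \<bullet> n" for j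
  have "\<exists>j. g j * g (Suc j) \<ge> 0"
  proof (rule ccontr)
    assume "\<not> ?thesis"
    then have alt: "g j * g (Suc j) < 0" for j by (simp add: not_le)
    \<comment> \<open>Strict alternation would give \<open>g N\<close> the sign opposite to \<open>g 0\<close>, as \<open>N\<close> is odd.\<close>
    have "g 0 * ((- 1) ^ j * g j) > 0" for j
    proof (induction j)
      case 0
      have "g 0 \<noteq> 0" using alt[of 0] by auto
      then show ?case by (simp add: not_square_less_zero less_le)
    next
      case (Suc j)
      then show ?case using alt[of j] 
        by (auto simp: zero_less_mult_iff mult_less_0_iff)
    qed
    from this[of N] have "- (g 0 * g N) > 0" using N by simp
    moreover have "g N = g 0" using N(2)[of 0] N(2)[of 1] by (simp add: g_def)
    ultimately show False by (simp add: not_less)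
  qed
  then obtain j where j: "g j * g (Suc j) \<ge> 0" ..
  define v p q where "v = F (Suc j)" and "p = F j" and "q = F (Suc (Suc j))"
  have vpq: "v \<in> S" "p \<in> S" "q \<in> S" "dist v p = d" "dist v q = d"
    using F by (auto simp: v_def p_def q_def dist_commute)
  have ne: "v \<noteq> a" "v \<noteq> b" "v \<noteq> c" "p \<noteq> a" "p \<noteq> b" "p \<noteq> c" "q \<noteq> a" "q \<noteq> b" "q \<noteq> c"
    using avoid by (auto simp: v_def p_def q_def)
  obtain s t where st: "s \<ge> 0" "t \<ge> 0" "s + t > 0"
    "(s *\<^sub>R (p - v) + t *\<^sub>R (q - v)) \<bullet> n = 0"
  proof (cases "g j = 0 \<and> g (Suc j) = 0")
    case True
    have "(1 *\<^sub>R (p - v) + 0 *\<^sub>R (q - v)) \<bullet> n = - g j"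
      by (simp add: g_def p_def v_def inner_diff_left)
    then show ?thesis using that[of 1 0] True by simp
  next
    case False
    have "(\<bar>g (Suc j)\<bar> *\<^sub>R (p - v) + \<bar>g j\<bar> *\<^sub>R (q - v)) \<bullet> n
        = - (\<bar>g (Suc j)\<bar> * g j) + \<bar>g j\<bar> * g (Suc j)"
      by (simp add: g_def p_def v_def q_def inner_add_left inner_diff_left algebra_simps)
    also have "\<dots> = 0" using j by (auto simp: abs_if zero_le_mult_iff)
    finally show ?thesis using that[of "\<bar>g (Suc j)\<bar>" "\<bar>g j\<bar>"] False by auto
  qed
  define w where "w = s *\<^sub>R (p - v) + t *\<^sub>R (q - v)"
  have e: "(b - a) \<bullet> (b - a) = d\<^sup>2" "(c - a) \<bullet> (c - a) = d\<^sup>2" "(b - c) \<bullet> (b - c) = d\<^sup>2"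
    using T by (simp_all add: dist_norm norm_minus_commute flip: power2_norm_eq_inner)
  have "n \<noteq> 0"
  proof
    assume "n = 0"
    have "(b - c) \<bullet> (b - c)
        = (b - a) \<bullet> (b - a) + (c - a) \<bullet> (c - a) - 2 * ((b - a) \<bullet> (c - a))"
      by (simp add: algebra_simps inner_commute)
    then have h1: "(b - a) \<bullet> (c - a) = d\<^sup>2 / 2" using e by simp
    have "((b - a) \<bullet> (c - a))\<^sup>2 = (norm (b - a))\<^sup>2 * (norm (c - a))\<^sup>2"
      using \<open>n = 0\<close> norm_and_cross_eq_0 norm_cross_dot[of "b - a" "c - a"] 
      unfolding n_def by (simp add: power_mult_distrib)
    then have "(d\<^sup>2 / 2)\<^sup>2 = d\<^sup>2 * d\<^sup>2"
      unfolding h1 power2_norm_eq_inner e .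
    then show False using d by (simp add: power2_eq_square)
  qed
  moreover have "w \<bullet> n = 0" using st by (simp add: w_def)
  ultimately obtain l k where lk: "w = l *\<^sub>R (b - a) + k *\<^sub>R (c - a)"
    using orthogonal_cross3_imp_combination unfolding n_def by blast
  have "w \<noteq> 0"
  proof
    assume "w = 0"
    then have "0 *\<^sub>R (p - v) + 0 *\<^sub>R (q - v) = s *\<^sub>R (p - v) + t *\<^sub>R (q - v)"
      by (simp add: w_def)
    then have "(p - v) \<bullet> (s *\<^sub>R (p - v) + t *\<^sub>R (q - v)) = 0" by simp
    moreover have "(p - v) \<bullet> (s *\<^sub>R (p - v) + t *\<^sub>R (q - v)) \<ge> (s + t) * (norm (p - v))\<^sup>2 / 2"
      using vpq st S d by (intro inner_cone_ge[where d = d]) auto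
    moreover have "(norm (p - v))\<^sup>2 > 0" using vpq d by auto
    ultimately show False using st by (smt (verit) divide_pos_pos mult_pos_pos)
  qed
  \<comment> \<open>No sector at any corner \<open>x\<close> of the triangle contains \<open>w\<close> or \<open>- w\<close>.\<close>
  have opp: False
    if xyz: "x \<in> {a, b, c}" "y \<in> {a, b, c}" "z \<in> {a, b, c}" and dxyz: "dist x y = d" "dist x z = d" "dist y z = d"
      and nn: "l \<ge> 0" "k \<ge> 0"
      and w: "w = l *\<^sub>R (y - x) + k *\<^sub>R (z - x) \<or> - w = l *\<^sub>R (y - x) + k *\<^sub>R (z - x)"
    for x y z l k
  proof -
    have inS: "x \<in> S" "y \<in> S" "z \<in> S" and ne: "v \<noteq> x" "v \<noteq> y" "v \<noteq> z" "p \<noteq> x"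
      using xyz T ne by auto
    have bd: "dist v x \<le> d" "dist v y \<le> d" "dist v z \<le> d" "dist x p \<le> d" "dist x q \<le> d"
      "dist p y \<le> d" "dist p z \<le> d" "dist q y \<le> d" "dist q z \<le> d"
      using inS vpq S by blast+
    have "l \<noteq> 0 \<or> k \<noteq> 0" using \<open>w \<noteq> 0\<close> w by auto
    then have lk: "l + k > 0" using nn by linarith
    from w show False
    proof
      assume "w = l *\<^sub>R (y - x) + k *\<^sub>R (z - x)"
      then have eq: "l *\<^sub>R (y - x) + k *\<^sub>R (z - x) = s *\<^sub>R (p - v) + t *\<^sub>R (q - v)" 
        by (simp add: w_def)
      have "v = x"
        using dxyz(1,2) vpq(4,5) bd(2-5) nn lk st(1,2) eq by (rule neighbour_cones_disjoint)
      then show False using ne by simp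
    next
      assume "- w = l *\<^sub>R (y - x) + k *\<^sub>R (z - x)"
      then have eq: "l *\<^sub>R (y - x) + k *\<^sub>R (z - x) = - (s *\<^sub>R (p - v) + t *\<^sub>R (q - v))" 
        by (simp add: w_def)
      have "v = y \<or> v = z \<or> p = x"
        using d dxyz vpq(4,5) bd(1,6-9) nn lk st(1,2) eq by (rule opposite_cones_meet_in_edge)
      then show False using ne by simp
    qed
  qed
  have dT: "dist a b = d" "dist b a = d" "dist a c = d" "dist c a = d" "dist b c = d" "dist c b = d"
    using T by (simp_all add: dist_commute)
  show False
  \<comment> \<open>The signs of \<open>l\<close>, \<open>k\<close> and \<open>l + k\<close> tell which of the six sectors contains \<open>w\<close>.\<close>
  proof (cases "l \<ge> 0"; cases "k \<ge> 0")
    assume "l \<ge> 0" "k \<ge> 0"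
    then show False using opp[of a b c l k] lk dT by auto
  next
    assume "\<not> l \<ge> 0" "\<not> k \<ge> 0"
    then show False using opp[of a b c "- l" "- k"] lk dT by auto
  next
    assume s: "l \<ge> 0" "\<not> k \<ge> 0"
    show False
    proof (cases "l + k \<ge> 0")
      case True
      have "- w = (l + k) *\<^sub>R (a - b) + (- k) *\<^sub>R (c - b)" unfolding lk by (simp add: algebra_simps)
      then show False using opp[of b a c "l + k" "- k"] True s dT by auto
    next
      case False
      have "w = (- l - k) *\<^sub>R (a - c) + l *\<^sub>R (b - c)" unfolding lk by (simp add: algebra_simps)
      then show False using opp[of c a b "- l - k" l] False s dT by auto
    qed
  next
    assume s: "\<not> l \<ge> 0" "k \<ge> 0"
    show False
    proof (cases "l + k \<ge> 0")
      case True
      have "- w = (l + k) *\<^sub>R (a - c) + (- l) *\<^sub>R (b - c)" unfolding lk by (simp add: algebra_simps)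
      then show False using opp[of c a b "l + k" "- l"] True s dT by auto
    next
      case False
      have "w = (- l - k) *\<^sub>R (a - b) + k *\<^sub>R (c - b)" unfolding lk by (simp add: algebra_simps)
      then show False using opp[of b a c "- l - k" k] False s dT by auto
    qed
  qed
qed

section \<open>Rotations about an axis\<close>

lemma orthonormal_frame_expand:
  assumes "orthonormal_frame u v w"
  shows "x = (x \<bullet> u) *\<^sub>R u + (x \<bullet> v) *\<^sub>R v + (x \<bullet> w) *\<^sub>R w"
proof -
  have n: "norm u = 1" "norm v = 1" "norm w = 1"
    and o: "u \<bullet> v = 0" "u \<bullet> w = 0" "v \<bullet> w = 0" "v \<bullet> u = 0" "w \<bullet> u = 0" "w \<bullet> v = 0"
    using assms by (auto simp: orthonormal_frame_def orthogonal_def inner_commute)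
  have ne: "u \<noteq> v" "u \<noteq> w" "v \<noteq> w" using n o by (auto simp: norm_eq_sqrt_inner)
  have po: "pairwise orthogonal {u, v, w}" using o by (auto simp: pairwise_def orthogonal_def)
  moreover have "0 \<notin> {u, v, w}" using n by auto
  ultimately have "independent {u, v, w}" by (rule pairwise_orthogonal_independent)
  moreover have "card {u, v, w} = DIM(real^3)" using ne by simp
  ultimately have "x \<in> span {u, v, w}"
    using card_ge_dim_independent[of "{u, v, w}" UNIV] by auto
  then have "(\<Sum>b\<in>{u, v, w}. (x \<bullet> b) *\<^sub>R b) = x"
    using po n by (intro orthonormal_basis_expand) auto
  then show ?thesis using ne by (simp add: add.assoc)
qed

locale axis =
  fixes p u v w :: "real^3"
  assumes frame: "orthonormal_frame u v w"
begin

abbreviation rotation :: "real \<Rightarrow> real^3 \<Rightarrow> real^3" where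
  "rotation \<equiv> axis_rotation p u v w"

definition axis_dist :: "real^3 \<Rightarrow> real" where
  "axis_dist x = sqrt (((x - p) \<bullet> u)\<^sup>2 + ((x - p) \<bullet> v)\<^sup>2)"

lemma frame_inner:
  "u \<bullet> u = 1" "v \<bullet> v = 1" "w \<bullet> w = 1"
  "u \<bullet> v = 0" "u \<bullet> w = 0" "v \<bullet> w = 0" "v \<bullet> u = 0" "w \<bullet> u = 0" "w \<bullet> v = 0"
  using frame by (auto simp: orthonormal_frame_def orthogonal_def inner_commute norm_eq_1)

lemma axis_rotation_coordinates:
  "(rotation t x - p) \<bullet> u = cos t * ((x - p) \<bullet> u) - sin t * ((x - p) \<bullet> v)"
  "(rotation t x - p) \<bullet> v = sin t * ((x - p) \<bullet> u) + cos t * ((x - p) \<bullet> v)"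
  "(rotation t x - p) \<bullet> w = (x - p) \<bullet> w"
  unfolding axis_rotation_def by (simp_all add: inner_add_left frame_inner flip: diff_diff_eq)

lemma frame_eqI:
  assumes "(x - p) \<bullet> u = (y - p) \<bullet> u" "(x - p) \<bullet> v = (y - p) \<bullet> v" "(x - p) \<bullet> w = (y - p) \<bullet> w"
  shows "x = y"
  using orthonormal_frame_expand[OF frame, of "x - p"] orthonormal_frame_expand[OF frame, of "y - p"]
    assms by simp

lemma frame_dist_squared:
  "(dist x y)\<^sup>2 = ((x - p) \<bullet> u - (y - p) \<bullet> u)\<^sup>2 + ((x - p) \<bullet> v - (y - p) \<bullet> v)\<^sup>2
     + ((x - p) \<bullet> w - (y - p) \<bullet> w)\<^sup>2"
proof -
  define A B C where "A = (x - y) \<bullet> u" and "B = (x - y) \<bullet> v" and "C = (x - y) \<bullet> w"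
  have "(dist x y)\<^sup>2 = (x - y) \<bullet> (x - y)" by (simp add: dist_norm power2_norm_eq_inner)
  also have "x - y = A *\<^sub>R u + B *\<^sub>R v + C *\<^sub>R w"
    unfolding A_def B_def C_def by (rule orthonormal_frame_expand[OF frame])
  also have "(A *\<^sub>R u + B *\<^sub>R v + C *\<^sub>R w) \<bullet> (A *\<^sub>R u + B *\<^sub>R v + C *\<^sub>R w) = A\<^sup>2 + B\<^sup>2 + C\<^sup>2"
    by (simp add: inner_add_left inner_add_right frame_inner power2_eq_square)
  finally show ?thesis by (simp add: A_def B_def C_def inner_diff_left)
qed

lemma axis_rotation_compose:
  "rotation s (rotation t x) = rotation (s + t) x"
  by (rule frame_eqI; unfold axis_rotation_coordinates cos_add sin_add; (rule refl | algebra))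

lemma axis_rotation_zero: "rotation 0 x = x"
  by (rule frame_eqI) (simp_all add: axis_rotation_coordinates)

lemma axis_rotation_mod:
  assumes "k > 0"
  shows "rotation (2 * pi * real (j mod k) / real k) x = rotation (2 * pi * real j / real k) x"
proof -
  have "real j = real (j mod k) + real k * real (j div k)"
    by (metis mod_mult_div_eq of_nat_add of_nat_mult)
  then have "2 * pi * real j / real k = 2 * pi * real (j mod k) / real k + 2 * pi * real (j div k)"
    using assms by (simp add: field_simps)
  moreover have "cos (2 * pi * real n) = 1" "sin (2 * pi * real n) = 0" for n
    using cos_int_2pin[of "int n"] sin_int_2pin[of "int n"] by simp_all
  ultimately show ?thesis by (simp add: axis_rotation_def cos_add sin_add)
qed

lemma axis_rotation_isometry:
  "dist (rotation t x) (rotation t y) = dist x y"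
proof -
  define X Y where "X = (x - p) \<bullet> u - (y - p) \<bullet> u" and "Y = (x - p) \<bullet> v - (y - p) \<bullet> v"
  have "(cos t * X - sin t * Y)\<^sup>2 + (sin t * X + cos t * Y)\<^sup>2
      = ((sin t)\<^sup>2 + (cos t)\<^sup>2) * (X\<^sup>2 + Y\<^sup>2)"
    by algebra
  then have "(dist (rotation t x) (rotation t y))\<^sup>2 = (dist x y)\<^sup>2"
    unfolding frame_dist_squared axis_rotation_coordinates X_def Y_def sin_cos_squared_add
    by (simp add: right_diff_distrib) (simp add: algebra_simps)
  then show ?thesis by (simp add: power2_eq_iff_nonneg)
qed

lemma dist_axis_rotations:
  "(dist (rotation s x) (rotation t x))\<^sup>2
     = 2 * (axis_dist x)\<^sup>2 * (1 - cos (s - t))"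
proof -
  define X Y where "X = (x - p) \<bullet> u" and "Y = (x - p) \<bullet> v"
  have "(dist (rotation s x) (rotation t x))\<^sup>2
      = (cos s * X - sin s * Y - (cos t * X - sin t * Y))\<^sup>2
      + (sin s * X + cos s * Y - (sin t * X + cos t * Y))\<^sup>2"
    by (simp add: frame_dist_squared axis_rotation_coordinates X_def Y_def)
  also have "\<dots> = (X\<^sup>2 + Y\<^sup>2) * (((sin s)\<^sup>2 + (cos s)\<^sup>2) + ((sin t)\<^sup>2 + (cos t)\<^sup>2)
      - 2 * (cos s * cos t + sin s * sin t))"
    by algebra
  also have "\<dots> = 2 * (X\<^sup>2 + Y\<^sup>2) * (1 - cos (s - t))" by (simp add: cos_diff algebra_simps)
  finally show ?thesis by (simp add: axis_dist_def X_def Y_def)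
qed

text \<open>
  If the axis carries two vertices of an equilateral triangle, then it carries a whole side, and the
  third vertex is at the height \<open>sqrt 3 / 2 * d\<close> over it.
\<close>

lemma axis_dist_equidistant:
  assumes h: "axis_dist h = 0" "axis_dist c = 0"
    and d: "dist h c = d" "dist x h = d" "dist x c = d"
  shows "4 * (axis_dist x)\<^sup>2 = 3 * d\<^sup>2"
proof -
  have z: "(h - p) \<bullet> u = 0" "(h - p) \<bullet> v = 0" "(c - p) \<bullet> u = 0" "(c - p) \<bullet> v = 0"
    using h by (auto simp: axis_dist_def sum_power2_eq_zero_iff)
  define X H C where "X = (x - p) \<bullet> w" and "H = (h - p) \<bullet> w" and "C = (c - p) \<bullet> w"
  define \<rho> where "\<rho> = (axis_dist x)\<^sup>2"
  have e: "d\<^sup>2 = (H - C)\<^sup>2" "d\<^sup>2 = \<rho> + (X - H)\<^sup>2" "d\<^sup>2 = \<rho> + (X - C)\<^sup>2"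
    using frame_dist_squared[of h c] frame_dist_squared[of x h] frame_dist_squared[of x c] z d
    by (simp_all add: X_def H_def C_def \<rho>_def axis_dist_def)
  then have "(H - C) * (2 * X - H - C) = 0" by algebra
  then consider "H = C" | "2 * X = H + C" by fastforce
  then have "4 * \<rho> = 3 * d\<^sup>2"
  proof cases
    case 1
    then have "d\<^sup>2 = 0" using e by simp
    moreover have "\<rho> \<ge> 0" by (simp add: \<rho>_def)
    ultimately show ?thesis using e(2) zero_le_power2[of "X - H"] by linarith
  next
    case 2
    then show ?thesis using e by algebra
  qed
  then show ?thesis by (simp add: \<rho>_def)
qed

end

section \<open>Odd cycles\<close>

text \<open>
  A cycle of length \<open>n\<close> as an \<open>n\<close>-periodic sequence. Since no index is distinguished, one may
  start anywhere and rotations of a regular polygon become additions of indices. For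
  loop-free \<open>R\<close> and odd \<open>n\<close> it is a cycle in the usual sense, of length at least 3.
\<close>

definition cyclic_walk :: "('a \<times> 'a) set \<Rightarrow> nat \<Rightarrow> (nat \<Rightarrow> 'a) \<Rightarrow> bool" where
  "cyclic_walk R n F \<longleftrightarrow>
     0 < n \<and> (\<forall>j. (F j, F (Suc j)) \<in> R) \<and> (\<forall>i j. F i = F j \<longleftrightarrow> i mod n = j mod n)"

text \<open>
  At a repeated vertex a closed walk splits into two closed walks; if the length is odd, so is the
  length of one of the two parts. A shortest odd closed walk therefore repeats no vertex.
\<close>

lemma shortest_odd_closed_walk:
  assumes walk: "(u, u) \<in> R ^^ n" and n: "odd n"
    and min: "\<And>x k. (x, x) \<in> R ^^ k \<Longrightarrow> odd k \<Longrightarrow> n \<le> k"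
  shows "\<exists>F. cyclic_walk R n F"
proof -
  obtain f where f: "f 0 = u" "f n = u" "\<And>i. i < n \<Longrightarrow> (f i, f (Suc i)) \<in> R"
    using walk by (auto simp: relpow_fun_conv)
  have pos: "n > 0" using n by (cases n) auto
  have sub: "(f i, f j) \<in> R ^^ (j - i)" if "i \<le> j" "j \<le> n" for i j
    unfolding relpow_fun_conv using that f(3) by (intro exI[of _ "\<lambda>t. f (i + t)"]) auto
  have ne: "f i \<noteq> f j" if "i < j" "j < n" for i j
  proof
    assume e: "f i = f j"
    have "(f i, f i) \<in> R ^^ (j - i)" using sub[of i j] that e by simp
    moreover have "(f 0, f 0) \<in> R ^^ (i + (n - j))"
      unfolding relpow_add using sub[of 0 i] sub[of j n] that e f(1,2) by auto
    moreover have "odd (j - i) \<or> odd (i + (n - j))" using n that by auto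
    ultimately have "n \<le> j - i \<or> n \<le> i + (n - j)" using min by blast
    then show False using that by linarith
  qed
  have eq: "f i = f j \<longleftrightarrow> i = j" if "i < n" "j < n" for i j
    using ne[of i j] ne[of j i] that by (metis nat_neq_iff)
  have "cyclic_walk R n (\<lambda>j. f (j mod n))"
    unfolding cyclic_walk_def
  proof (intro conjI allI)
    fix j
    have "f (Suc j mod n) = f (Suc (j mod n))"
      using f(1,2) by (simp add: mod_Suc)
    then show "(f (j mod n), f (Suc j mod n)) \<in> R" using f(3) pos by simp
  qed (use pos eq in simp_all)
  then show ?thesis by blast
qed

text \<open>
  Without odd closed walks, the parity of the walks to \<open>x\<close> from a chosen root of its connected
  component is well defined and gives the colouring.
\<close>

lemma odd_cycle_or_two_colouring:
  assumes "sym R"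
  obtains (cycle) n F where "odd n" "cyclic_walk R n F"
  | (colouring) A where "\<And>x y. (x, y) \<in> R \<Longrightarrow> x \<in> A \<longleftrightarrow> y \<notin> A"
proof (cases "\<exists>n. odd n \<and> (\<exists>u. (u, u) \<in> R ^^ n)")
  case True
  define n where "n = (LEAST n. odd n \<and> (\<exists>u. (u, u) \<in> R ^^ n))"
  have "odd n \<and> (\<exists>u. (u, u) \<in> R ^^ n)" unfolding n_def by (rule LeastI_ex[OF True])
  then obtain u where "odd n" "(u, u) \<in> R ^^ n" by blast
  moreover have "n \<le> k" if "(x, x) \<in> R ^^ k" "odd k" for x k
    unfolding n_def using that by (intro Least_le) blast
  ultimately show ?thesis using shortest_odd_closed_walk cycle by metis
next
  case False
  have rev: "(y, x) \<in> R ^^ n" if "(x, y) \<in> R ^^ n" for x y n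
    using that
  proof (induction n arbitrary: y)
    case (Suc n)
    then obtain z where "(x, z) \<in> R ^^ n" "(z, y) \<in> R" by auto
    then show ?case using relpow_Suc_I2[OF symD[OF assms]] Suc.IH by metis
  qed simp
  define root where "root x = (SOME r. (r, x) \<in> R\<^sup>*)" for x
  have root: "(root x, x) \<in> R\<^sup>*" for x unfolding root_def by (rule someI[of _ x]) simp
  have root_eq: "root x = root y" if "(x, y) \<in> R" for x y
  proof -
    have "(r, x) \<in> R\<^sup>* \<longleftrightarrow> (r, y) \<in> R\<^sup>*" for r
      using that symD[OF assms that] by (meson rtrancl.rtrancl_into_rtrancl)
    then show ?thesis by (simp add: root_def)
  qed
  define A where "A = {x. \<exists>n. even n \<and> (root x, x) \<in> R ^^ n}"
  have "x \<in> A \<longleftrightarrow> y \<notin> A" if xy: "(x, y) \<in> R" for x y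
  proof -
    obtain n where n: "(root x, x) \<in> R ^^ n" using root rtrancl_imp_relpow by metis
    have y: "(root y, y) \<in> R ^^ Suc n" using n xy root_eq[OF xy] by auto
    have par: "even i \<longleftrightarrow> even j" if "(root z, z) \<in> R ^^ i" "(root z, z) \<in> R ^^ j" for z i j
    proof -
      have "(root z, root z) \<in> R ^^ (i + j)" using that rev unfolding relpow_add by blast
      then show ?thesis using False by (metis even_add)
    qed
    have "x \<in> A \<longleftrightarrow> even n" unfolding A_def using n par by blast
    moreover have "y \<in> A \<longleftrightarrow> even (Suc n)" unfolding A_def using y par by blast
    ultimately show ?thesis by simp
  qed
  then show ?thesis using colouring by blast
qed

section \<open>Subdivided wheels\<close>

text \<open>
  A hub \<open>h\<close> with spokes to a subset \<open>A\<close> of the vertices of the cycle \<open>xs\<close>. This family contains the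
  wheels (\<open>A = set xs\<close>) and is closed under subdividing rim edges, so that an induction on the length
  of the rim can stay inside it.
\<close>

definition rim_and_spokes :: "'a \<Rightarrow> 'a list \<Rightarrow> 'a set \<Rightarrow> 'a pair_pre_digraph" where
  "rim_and_spokes h xs A =
     (let E = set (zip xs (rotate1 xs)) \<union> {h} \<times> A in \<lparr>pverts = insert h (set xs), parcs = E \<union> E\<inverse>\<rparr>)"

lemma rim_and_spokes_arcs:
  assumes "distinct xs" "h \<notin> set xs" "A \<subseteq> set xs" "length xs \<ge> 2" "(x, y) \<in> parcs (rim_and_spokes h xs A)"
  shows "x \<in> insert h (set xs) \<and> y \<in> insert h (set xs) \<and> x \<noteq> y \<and> (y, x) \<in> parcs (rim_and_spokes h xs A)"
proof -
  have "x \<in> set xs \<and> y \<in> set xs \<and> x \<noteq> y" if "(x, y) \<in> set (zip xs (rotate1 xs))" for x y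
  proof -
    obtain i where i: "i < length xs" "x = xs ! i" "y = xs ! (Suc i mod length xs)"
      using \<open>(x, y) \<in> set (zip xs (rotate1 xs))\<close> by (auto simp: set_zip nth_rotate1)
    have "Suc i mod length xs \<noteq> i"
      using i assms(4) by (cases "Suc i = length xs") auto
    moreover have "Suc i mod length xs < length xs" using i(1) by (intro mod_less_divisor) linarith
    ultimately show ?thesis using i assms(1) nth_eq_iff_index_eq nth_mem by metis
  qed
  moreover have "x \<in> set xs \<and> x \<noteq> h" if "x \<in> A" for x using that assms(2,3) by auto
  ultimately show ?thesis using assms(5) unfolding rim_and_spokes_def Let_def by auto
qed

lemma pair_bidirected_rim_and_spokes:
  assumes "distinct xs" "h \<notin> set xs" "A \<subseteq> set xs" "length xs \<ge> 2"
  shows "pair_bidirected_digraph (rim_and_spokes h xs A)"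
proof -
  let ?G = "rim_and_spokes h xs A"
  have "pverts ?G = insert h (set xs)"
    by (simp add: rim_and_spokes_def Let_def)
  then have "x \<in> pverts ?G" "y \<in> pverts ?G" "x \<noteq> y" "(y, x) \<in> parcs ?G" if "(x, y) \<in> parcs ?G" for x y
    using rim_and_spokes_arcs[OF assms that] by simp_all
  then show ?thesis
    by unfold_locales (auto simp: symmetric_def intro!: symI)
qed

lemma wheel_graph_rim_and_spokes:
  assumes "distinct xs" "h \<notin> set xs" "length xs \<ge> 3"
  shows "wheel_graph (Suc (length xs)) (rim_and_spokes h xs (set xs))"
proof -
  let ?n = "length xs"
  have e: "set (zip xs (rotate1 xs)) = {(xs ! i, xs ! (Suc i mod ?n)) | i. i < ?n}"
    by (auto simp: set_zip nth_rotate1)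
  have s: "set xs = (!) xs ` {..<?n}" by (auto simp: in_set_conv_nth)
  have "inj_on ((!) xs) {..<?n}" using assms by (simp add: inj_on_nth)
  moreover have "parcs (rim_and_spokes h xs (set xs)) =
      (\<Union>i<?n. {(xs ! i, xs ! (Suc i mod ?n)), (xs ! (Suc i mod ?n), xs ! i), (h, xs ! i), (xs ! i, h)})"
  proof -
    have "{h} \<times> set xs = {(h, xs ! i) | i. i < ?n}" by (auto simp: in_set_conv_nth)
    then show ?thesis unfolding rim_and_spokes_def Let_def e by auto
  qed
  ultimately show ?thesis
    unfolding wheel_graph_def using assms s
    by (intro conjI exI[of _ h] exI[of _ "(!) xs"]) (auto simp: rim_and_spokes_def Let_def)
qed

text \<open>
  Rotating the list brings any given vertex of the rim to the end, where it is easy to remove.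
\<close>

lemma rim_and_spokes_rotate: "rim_and_spokes h (us @ vs) A = rim_and_spokes h (vs @ us) A"
proof -
  have one: "rim_and_spokes h (rotate1 xs) A = rim_and_spokes h xs A" for xs :: "'a list"
  proof -
    have "zip (rotate1 xs) (rotate1 (rotate1 xs)) = rotate1 (zip xs (rotate1 xs))"
    proof (intro nth_equalityI)
      fix i assume "i < length (zip (rotate1 xs) (rotate1 (rotate1 xs)))"
      then have "i < length xs" by simp
      moreover from this have "Suc i mod length xs < length xs" by (intro mod_less_divisor) linarith
      ultimately show "zip (rotate1 xs) (rotate1 (rotate1 xs)) ! i = rotate1 (zip xs (rotate1 xs)) ! i"
        by (simp add: nth_rotate1)
    qed simp
    then show ?thesis by (simp add: rim_and_spokes_def)
  qed
  have "rim_and_spokes h (rotate n xs) A = rim_and_spokes h xs A" for n and xs :: "'a list"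
    by (induction n) (simp_all add: one)
  from this[of "length us" "us @ vs"] show ?thesis by (simp add: rotate_append)
qed

text \<open>
  The last rim vertex \<open>x\<close>, if it carries no spoke, subdivides the edge from the last to the first
  vertex of the shorter rim \<open>L\<close>. At least three vertices in \<open>L\<close> are needed for this edge to occur only
  once in the rim, so that subdividing removes nothing else.
\<close>

lemma rim_and_spokes_subdivide:
  assumes "distinct (L @ [x])" "length L \<ge> 3" "h \<notin> set (L @ [x])" "A \<subseteq> set L"
  obtains y z where "(y, z) \<in> parcs (rim_and_spokes h L A)"
    "rim_and_spokes h (L @ [x]) A = subdivide (rim_and_spokes h L A) (y, z) x"
proof -
  obtain z m M y where L: "L = z # (m # M) @ [y]"
  proof -
    obtain z L' where "L = z # L'" using assms(2) by (cases L) auto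
    moreover obtain m L'' where "L' = m # L''" using assms(2) calculation by (cases L') auto
    moreover obtain M y where "L'' = M @ [y]" using assms(2) calculation by (cases L'' rule: rev_cases) auto
    ultimately show ?thesis using that by simp
  qed
  define P where "P = set (zip (z # m # M) (m # M @ [y]))"
  have zL: "set (zip L (rotate1 L)) = P \<union> {(y, z)}"
    and zLx: "set (zip (L @ [x]) (rotate1 (L @ [x]))) = P \<union> {(y, x), (x, z)}"
  proof -
    have "zip L (rotate1 L) = zip ((z # m # M) @ [y]) ((m # M @ [y]) @ [z])"
      by (simp add: L)
    also have "\<dots> = zip (z # m # M) (m # M @ [y]) @ [(y, z)]" by (subst zip_append) auto
    finally show "set (zip L (rotate1 L)) = P \<union> {(y, z)}" by (auto simp: P_def)
    have "zip (L @ [x]) (rotate1 (L @ [x])) = zip ((z # m # M) @ [y, x]) ((m # M @ [y]) @ [x, z])"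
      by (simp add: L)
    also have "\<dots> = zip (z # m # M) (m # M @ [y]) @ [(y, x), (x, z)]" by (subst zip_append) auto
    finally show "set (zip (L @ [x]) (rotate1 (L @ [x]))) = P \<union> {(y, x), (x, z)}" by (auto simp: P_def)
  qed
  have P: "(y, z) \<notin> P" "(z, y) \<notin> P"
    using assms(1) by (auto simp: P_def L dest: set_zip_leftD set_zip_rightD)
  have ne: "h \<noteq> y" "h \<noteq> z" using assms(3) by (auto simp: L)
  have yz: "(y, z) \<in> parcs (rim_and_spokes h L A)"
    by (simp add: rim_and_spokes_def Let_def zL)
  have "parcs (rim_and_spokes h (L @ [x]) A) = parcs (subdivide (rim_and_spokes h L A) (y, z) x)"
    unfolding arcs_subdivide rim_and_spokes_def Let_def zL zLx pair_pre_digraph.simps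
    using P ne by auto
  moreover have "pverts (rim_and_spokes h (L @ [x]) A) = pverts (subdivide (rim_and_spokes h L A) (y, z) x)"
    by (auto simp: rim_and_spokes_def Let_def)
  ultimately show ?thesis using that[OF yz] by simp
qed

text \<open>
  Removing the rim vertices without spoke one by one ends in the wheel whose rim is \<open>A\<close>.
\<close>

lemma topological_wheel_rim_and_spokes:
  assumes "distinct xs" "h \<notin> set xs" "A \<subseteq> set xs" "card A \<ge> 3"
  shows "topological_wheel_graph (Suc (card A)) (rim_and_spokes h xs A)"
  using assms
proof (induction "length xs" arbitrary: xs rule: less_induct)
  case less
  have len: "length xs \<ge> card A" 
    using less.prems by (metis card_mono distinct_card finite_set)
  show ?case
  proof (cases "A = set xs")
    case True
    then have card: "card A = length xs" using less.prems by (simp add: distinct_card)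
    show ?thesis
      using wheel_graph_rim_and_spokes[of xs h] less.prems len card True
        subdivision_pair_base[OF pair_bidirected_rim_and_spokes[of xs h A]]
      unfolding topological_wheel_graph_def by auto
  next
    case False
    then obtain x where x: "x \<in> set xs" "x \<notin> A" using less.prems by auto
    then obtain us vs where xs: "xs = us @ x # vs" by (meson split_list)
    define L where "L = vs @ us"
    have rot: "rim_and_spokes h xs A = rim_and_spokes h (L @ [x]) A"
      using rim_and_spokes_rotate[of h "us @ [x]" vs A] by (simp add: xs L_def)
    have L: "distinct L" "x \<notin> set L" "h \<notin> set (L @ [x])" "A \<subseteq> set L" "length L < length xs"
      using less.prems x by (auto simp: L_def xs)
    have "topological_wheel_graph (Suc (card A)) (rim_and_spokes h L A)"
      using less L by simp
    then obtain W where W: "wheel_graph (Suc (card A)) W" "subdivision_pair W (rim_and_spokes h L A)"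
      unfolding topological_wheel_graph_def by blast
    have "length L \<ge> 3" using L less.prems by (metis card_mono distinct_card finite_set le_trans)
    then obtain y z where yz: "(y, z) \<in> parcs (rim_and_spokes h L A)"
      "rim_and_spokes h (L @ [x]) A = subdivide (rim_and_spokes h L A) (y, z) x"
      using L by (elim rim_and_spokes_subdivide[rotated]) auto
    have "x \<notin> pverts (rim_and_spokes h L A)"
      using L by (auto simp: rim_and_spokes_def Let_def)
    then have "subdivision_pair W (rim_and_spokes h xs A)"
      unfolding rot yz(2) using yz(1) W(2) by (intro subdivision_pair_divide)
    then show ?thesis using W(1) unfolding topological_wheel_graph_def by blast
  qed
qed

lemma cyclic_walk_shift:
  assumes "cyclic_walk R n F"
  shows "F (j + n) = F j"
  using assms by (simp add: cyclic_walk_def)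

text \<open>
  The form in which wheels are found below: a cycle, and outside it a vertex with many neighbours
  on the cycle.
\<close>

lemma topological_wheel_in_graph:
  assumes G: "pair_bidirected_digraph G"
    and F: "cyclic_walk (parcs G) n F" "h \<notin> range F"
    and A: "A \<subseteq> range F" "\<And>x. x \<in> A \<Longrightarrow> (h, x) \<in> parcs G" "card A \<ge> 3"
  shows "\<exists>H. topological_wheel_graph (Suc (card A)) H \<and> subgraph (with_proj H) (with_proj G)"
proof -
  interpret G: pair_bidirected_digraph G by (rule G)
  have n: "n > 0" and step: "\<And>j. (F j, F (Suc j)) \<in> parcs G"
    and eq: "\<And>i j. F i = F j \<longleftrightarrow> i mod n = j mod n"
    using F by (auto simp: cyclic_walk_def)
  define xs where "xs = map F [0..<n]"
  have range: "range F = set xs"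
  proof -
    have "F i = F (i mod n)" for i by (simp add: eq)
    moreover have "i mod n \<in> {0..<n}" for i using n by simp
    ultimately have "F i \<in> F ` {0..<n}" for i by (metis imageI)
    then show ?thesis by (auto simp: xs_def)
  qed
  have dist: "distinct xs"
    by (auto simp: xs_def distinct_map inj_on_def eq)
  have len: "length xs \<ge> 3"
    using card_mono[of "set xs" A] A range distinct_card[OF dist] by simp
  define H where "H = rim_and_spokes h xs A"
  have "topological_wheel_graph (Suc (card A)) H"
    unfolding H_def using F A dist range by (intro topological_wheel_rim_and_spokes) auto
  moreover have "subgraph (with_proj H) (with_proj G)"
  proof -
    have "set (zip xs (rotate1 xs)) \<subseteq> parcs G"
    proof -
      have "(xs ! i, xs ! (Suc i mod n)) \<in> parcs G" if "i < n" for i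
      proof -
        have "xs ! (Suc i mod n) = F (Suc i)" using n by (simp add: xs_def eq)
        then show ?thesis using step that by (simp add: xs_def)
      qed
      then show ?thesis by (auto simp: set_zip nth_rotate1 xs_def)
    qed
    then have arcs: "parcs H \<subseteq> parcs G"
      using A(2) G.arcs_symmetric by (auto simp: H_def rim_and_spokes_def Let_def)
    interpret H: pair_bidirected_digraph H
      unfolding H_def using F A dist range len by (intro pair_bidirected_rim_and_spokes) auto
    obtain a where "a \<in> A" using A(3) by fastforce
    then have "h \<in> pverts G" using A(2) G.in_arcsD1 by blast
    moreover have "set xs \<subseteq> pverts G" using step G.in_arcsD1 by (auto simp flip: range)
    ultimately have "pverts H \<subseteq> pverts G" by (simp add: H_def rim_and_spokes_def Let_def)
    then show ?thesis
      unfolding subgraph_def using arcs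
      by (simp add: compatible_def G.wf_digraph_axioms H.wf_digraph_axioms)
  qed
  ultimately show ?thesis by blast
qed

section \<open>Borsuk number and girth of finite sets\<close>

lemma diameter_less_if_not_attained:
  fixes S :: "'a::metric_space set"
  assumes "finite S" "A \<subseteq> S" "diameter S > 0"
    and "\<And>x y. x \<in> A \<Longrightarrow> y \<in> A \<Longrightarrow> dist x y \<noteq> diameter S"
  shows "diameter A < diameter S"
proof (cases "A = {}")
  case False
  have "finite A" using assms finite_subset by blast
  then obtain x y where xy: "x \<in> A" "y \<in> A" "dist x y = diameter A"
    using diameter_compact_attained[of A] False finite_imp_compact by metis
  moreover have "diameter A \<le> diameter S"
    using assms by (intro diameter_subset finite_imp_bounded)
  ultimately show ?thesis using assms(4)[OF xy(1,2)] by linarith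
qed (use assms in simp)

text \<open>
  A subset of a finite set has smaller diameter as soon as it is independent in the diameter graph.
  So if deleting a vertex \<open>h\<close> makes the graph bipartite, the two colour classes and \<open>{h}\<close> are a
  covering by three pieces of smaller diameter.
\<close>

lemma borsuk_number_le_3:
  fixes S :: "'a::metric_space set"
  assumes S: "finite S" "diameter S > 0"
    and col: "\<And>x y. x \<in> S - {h} \<Longrightarrow> y \<in> S - {h} \<Longrightarrow> dist x y = diameter S \<Longrightarrow> x \<in> A \<longleftrightarrow> y \<notin> A"
  shows "borsuk_number S \<le> 3"
proof -
  define F where "F = {S \<inter> {h}, (S - {h}) \<inter> A, S - {h} - A}"
  have "diameter B < diameter S" if "B \<in> F" for B
  proof (rule diameter_less_if_not_attained)
    show "B \<subseteq> S" using that by (auto simp: F_def)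
    show "dist x y \<noteq> diameter S" if "x \<in> B" "y \<in> B" for x y
      using \<open>B \<in> F\<close> that col[of x y] S(2) by (auto simp: F_def)
  qed (use S in auto)
  moreover have "bounded B" if "B \<in> F" for B
    using that S by (auto simp: F_def intro!: finite_imp_bounded)
  moreover have "finite F" "S \<subseteq> \<Union>F" by (auto simp: F_def)
  ultimately have "borsuk_number S \<le> enat (card F)"
    unfolding borsuk_number_def by (intro Inf_lower) blast
  also have "card F \<le> 3" unfolding F_def by (simp add: card_insert_if)
  then have "enat (card F) \<le> 3" by (simp add: numeral_eq_enat)
  finally show ?thesis .
qed

lemma girth_3_imp_triangle:
  assumes "girth (with_proj G) = 3"
  obtains x y z where "(x, y) \<in> parcs G" "(y, z) \<in> parcs G" "(z, x) \<in> parcs G"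
proof -
  define L where "L = {enat (length p) | p. pre_digraph.cycle (with_proj G) p \<and> 3 \<le> length p}"
  have L: "Inf L = 3" using assms by (simp add: girth_def L_def)
  then have "L \<noteq> {}" by (auto simp: top_enat_def)
  then have "3 \<in> L" using L wellorder_InfI by (metis ex_in_conv)
  then obtain p where p: "pre_digraph.cycle (with_proj G) p" "length p = 3"
    by (auto simp: L_def numeral_eq_enat)
  then obtain e f g where efg: "p = [e, f, g]"
    by (auto simp: numeral_eq_Suc length_Suc_conv)
  obtain u where u: "set p \<subseteq> parcs G" "pcas u p u"
    using p(1) unfolding pre_digraph.cycle_def pre_digraph.awalk_def cas_with_proj_eq by auto
  then have "(fst e, fst f) \<in> parcs G" "(fst f, fst g) \<in> parcs G" "(fst g, fst e) \<in> parcs G"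
    unfolding efg by (cases e; cases f; cases g; auto)+
  then show ?thesis by (rule that)
qed

lemma pair_bidirected_diameter_graph: "pair_bidirected_digraph (diameter_graph S)"
  by unfold_locales (auto simp: diameter_graph_def symmetric_def dist_commute intro!: symI)

section \<open>Diameter graphs with rotational symmetry\<close>

locale rotation_symmetric_set = axis +
  fixes m :: nat and S :: "(real^3) set"
  assumes m: "m \<ge> 2"
    and invariant: "\<And>j x. x \<in> S \<Longrightarrow> rotation (2 * pi * real j / real (2 * m + 1)) x \<in> S"
    and bounded: "bounded S" and diameter: "diameter S > 0"
begin

definition turn :: "nat \<Rightarrow> real^3 \<Rightarrow> real^3" where
  "turn j = rotation (2 * pi * real j / real (2 * m + 1))"

lemma turn_mem: "x \<in> S \<Longrightarrow> turn j x \<in> S"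
  unfolding turn_def by (rule invariant)

lemma dist_le_diameter: "x \<in> S \<Longrightarrow> y \<in> S \<Longrightarrow> dist x y \<le> diameter S"
  using bounded by (rule diameter_bounded_bound)

lemma diameter_graph_arc:
  "x \<in> S \<Longrightarrow> y \<in> S \<Longrightarrow> dist x y = diameter S \<Longrightarrow> (x, y) \<in> parcs (diameter_graph S)"
  using diameter by (auto simp: diameter_graph_def)

lemma turn_turn: "turn i (turn j x) = turn (i + j) x"
  unfolding turn_def axis_rotation_compose
  by (simp add: distrib_left add_divide_distrib)

lemma turn_0: "turn 0 x = x"
  by (simp add: turn_def axis_rotation_zero)

lemma turn_mod: "turn (j mod (2 * m + 1)) x = turn j x"
  unfolding turn_def by (rule axis_rotation_mod) simp

lemma dist_turn_turn: "dist (turn j x) (turn j y) = dist x y"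
  unfolding turn_def by (rule axis_rotation_isometry)

lemma dist_turns:
  "(dist (turn i x) (turn j x))\<^sup>2
     = 2 * (axis_dist x)\<^sup>2 * (1 - cos (2 * pi * (real i - real j) / real (2 * m + 1)))"
  unfolding turn_def dist_axis_rotations 
  by (simp add: right_diff_distrib diff_divide_distrib)

lemma turn_on_axis: "axis_dist x = 0 \<Longrightarrow> turn j x = x"
  using dist_turns[of j x 0] by (simp add: turn_0)

lemma turn_eq_iff:
  assumes "axis_dist x \<noteq> 0"
  shows "turn i x = turn j x \<longleftrightarrow> i mod (2 * m + 1) = j mod (2 * m + 1)"
proof
  assume "turn i x = turn j x"
  then have "cos (2 * pi * (real i - real j) / real (2 * m + 1)) = 1"
    using dist_turns[of i x j] assms by simp
  then obtain n :: int where "2 * pi * (real i - real j) / real (2 * m + 1) = of_int n * 2 * pi"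
    by (auto simp: cos_one_2pi_int)
  then have "2 * pi * ((real i - real j) / real (2 * m + 1) - of_int n) = 0"
    by (simp add: right_diff_distrib)
  then have "(real i - real j) / real (2 * m + 1) = of_int n" by simp
  then have "real i - real j = of_int n * real (2 * m + 1)" by (simp add: divide_eq_eq)
  then have "of_int (int i - int j) = (of_int (n * int (2 * m + 1)) :: real)" by simp
  then have "int i - int j = n * int (2 * m + 1)" by (simp only: of_int_eq_iff)
  then have "[int i = int j] (mod int (2 * m + 1))"
    by (simp add: cong_iff_dvd_diff)
  then show "i mod (2 * m + 1) = j mod (2 * m + 1)"
    by (metis cong_def cong_int_iff)
next
  assume "i mod (2 * m + 1) = j mod (2 * m + 1)"
  then show "turn i x = turn j x" by (metis turn_mod)
qed

text \<open>
  A point off the axis has a regular \<open>(2 * m + 1)\<close>-gon as its orbit, so only the longest diagonals of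
  the polygon, which lead \<open>m\<close> or \<open>m + 1\<close> vertices further, can have the length of the diameter: an equally
  long shorter chord would leave the longest ones longer than the diameter.
\<close>

lemma long_chord:
  assumes x: "x \<in> S" "axis_dist x \<noteq> 0"
    and j: "j < 2 * m + 1" "dist (turn j x) x = diameter S"
  shows "j = m \<or> j = m + 1"
proof (rule ccontr)
  assume not: "\<not> ?thesis"
  define angle where "angle i = 2 * pi * real i / real (2 * m + 1)" for i
  \<comment> \<open>The number of sides that the chord cuts off on its shorter side.\<close>
  define i where "i = (if j < m then j else 2 * m + 1 - j)"
  have i: "i < m" using not j by (auto simp: i_def)
  have "cos (angle i) = cos (angle j)"
  proof (cases "j < m")
    case False
    have "angle i = 2 * pi - angle j"
      using False j(1) by (simp add: angle_def i_def field_simps)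
    then show ?thesis by simp
  qed (simp add: i_def)
  moreover have "cos (angle m) < cos (angle i)"
  proof (rule cos_monotone_0_pi)
    show "0 \<le> angle i" by (simp add: angle_def)
    show "angle i < angle m" using i by (simp add: angle_def divide_strict_right_mono)
    show "angle m \<le> pi" by (simp add: angle_def field_simps)
  qed
  ultimately have "1 - cos (angle j) < 1 - cos (angle m)" by simp
  then have "2 * (axis_dist x)\<^sup>2 * (1 - cos (angle j))
      < 2 * (axis_dist x)\<^sup>2 * (1 - cos (angle m))"
    using x by (intro mult_strict_left_mono) auto
  then have "(dist (turn j x) x)\<^sup>2 < (dist (turn m x) x)\<^sup>2"
    using dist_turns[of j x 0] dist_turns[of m x 0] by (simp add: turn_0 angle_def)
  then have "diameter S < dist (turn m x) x"
    using j by (metis power2_less_imp_less zero_le_dist)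
  then show False using dist_le_diameter[OF turn_mem[OF x(1), of m] x(1)] by simp
qed

text \<open>
  The triangle and its image under the smallest rotation share a vertex \<open>x\<close>, the image of a vertex
  \<open>y\<close>. If \<open>y\<close> were off the axis, \<open>x\<close> and \<open>y\<close> would span a side of a regular polygon, and this side would
  have the length of the diameter; but for \<open>m \<ge> 2\<close> the polygon has longer diagonals.
\<close>

lemma triangle_meets_axis:
  assumes T: "a \<in> S" "b \<in> S" "c \<in> S"
    "dist a b = diameter S" "dist a c = diameter S" "dist b c = diameter S"
  shows "\<exists>h\<in>{a, b, c}. axis_dist h = 0"
proof -
  \<comment> \<open>The image of the triangle as a closed walk of length 3.\<close>
  define F where "F j = turn 1 (if j mod 3 = 0 then a else if j mod 3 = 1 then b else c)" for j :: nat
  have "\<exists>j. F j \<in> {a, b, c}"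
  proof (rule triangle_meets_odd_closed_walk[where d = "diameter S" and S = S and N = 3])
    show "F j \<in> S" for j using T by (simp add: F_def turn_mem)
    show "dist (F j) (F (Suc j)) = diameter S" for j
    proof -
      have "j mod 3 < 3" by simp
      then consider "j mod 3 = 0" | "j mod 3 = 1" | "j mod 3 = 2" by linarith
      then show ?thesis
        unfolding F_def dist_turn_turn using T by cases (simp_all add: mod_Suc dist_commute)
    qed
    show "F (j + 3) = F j" for j by (simp add: F_def)
  qed (use T diameter dist_le_diameter in auto)
  then obtain x y where xy: "x \<in> {a, b, c}" "y \<in> {a, b, c}" "x = turn 1 y"
    unfolding F_def by (auto split: if_splits)
  have "y \<in> S" using xy T by auto
  have "axis_dist y = 0"
  proof (rule ccontr)
    assume off: "axis_dist y \<noteq> 0"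
    show False
    proof (cases "x = y")
      case True
      then have "turn 1 y = turn 0 y" using xy by (simp add: turn_0)
      then show False using turn_eq_iff[OF off] m by simp
    next
      case False
      then have "dist (turn 1 y) y = diameter S" using xy T by (auto simp: dist_commute)
      then show False using long_chord[OF \<open>y \<in> S\<close> off, of 1] m by simp
    qed
  qed
  then show ?thesis using xy by blast
qed

text \<open>
  With two vertices on the axis, the third would have an orbit of radius \<open>sqrt 3 / 2\<close> times the
  diameter. For \<open>m \<ge> 2\<close> its longest diagonals subtend an obtuse angle at the centre, so they are longer
  than \<open>sqrt 2\<close> times the radius and exceed the diameter.
\<close>

lemma triangle_meets_axis_once:
  assumes "axis_dist h = 0" "b \<in> S"
    "dist h b = diameter S" "dist h c = diameter S" "dist b c = diameter S"
  shows "axis_dist c \<noteq> 0"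
proof
  assume "axis_dist c = 0"
  then have r: "4 * (axis_dist b)\<^sup>2 = 3 * (diameter S)\<^sup>2"
    using assms by (intro axis_dist_equidistant[of h c]) (auto simp: dist_commute)
  define \<theta> where "\<theta> = 2 * pi * real m / real (2 * m + 1)"
  have "cos \<theta> < cos (pi / 2)"
  proof (rule cos_monotone_0_pi)
    show "pi / 2 < \<theta>" using m pi_gt_zero by (simp add: \<theta>_def field_simps)
    show "\<theta> \<le> pi" by (simp add: \<theta>_def field_simps)
  qed simp
  then have "1 \<le> 1 - cos \<theta>" by simp
  then have "2 * (axis_dist b)\<^sup>2 * 1 \<le> 2 * (axis_dist b)\<^sup>2 * (1 - cos \<theta>)"
    by (intro mult_left_mono) auto
  also have "\<dots> = (dist (turn m b) b)\<^sup>2"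
    using dist_turns[of m b 0] by (simp add: turn_0 \<theta>_def)
  also have "\<dots> \<le> (diameter S)\<^sup>2"
    using dist_le_diameter[OF turn_mem[OF assms(2), of m] assms(2)] by (intro power_mono) auto
  finally show False using r diameter zero_less_power[of "diameter S" 2] by linarith
qed

text \<open>
  When the two vertices of the triangle off the axis are in the same orbit, they span a longest diagonal.
  As \<open>m\<close> and \<open>m + 1\<close> are coprime to \<open>2 * m + 1\<close>, the longest diagonals of the orbit form a single cycle
  through all its points, all of which are joined to \<open>h\<close>. This is a wheel without subdivisions.
\<close>

lemma wheel_of_diagonals:
  assumes h: "h \<in> S" "axis_dist h = 0" "dist h b = diameter S"
    and b: "b \<in> S" "axis_dist b \<noteq> 0" "dist b (turn j b) = diameter S"
  shows "\<exists>H. topological_wheel_graph (2 * m + 2) H \<and>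
             subgraph (with_proj H) (with_proj (diameter_graph S))"
proof -
  define k where "k = 2 * m + 1"
  define j' where "j' = j mod k"
  have j': "turn j' x = turn j x" for x unfolding j'_def k_def by (rule turn_mod)
  have "j' = m \<or> j' = m + 1"
    using b j' by (intro long_chord[of b]) (simp_all add: dist_commute j'_def k_def)
  then have "k = Suc (2 * j') \<or> 2 * j' = Suc k" by (auto simp: k_def)
  then have "coprime (2 * j') k"
    by (metis coprime_Suc_left_nat coprime_Suc_right_nat)
  then have cop: "coprime j' k" by simp
  define F where "F i = turn (j' * i) b" for i
  have hF: "dist h (F i) = diameter S" for i
    using dist_turn_turn[of "j' * i" h b] h by (simp add: F_def turn_on_axis)
  have F_eq: "F i = F i' \<longleftrightarrow> i mod k = i' mod k" for i i'
  proof -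
    have "F i = F i' \<longleftrightarrow> [j' * i = j' * i'] (mod k)"
      unfolding F_def turn_eq_iff[OF b(2)] by (simp add: cong_def k_def)
    also have "\<dots> \<longleftrightarrow> [i = i'] (mod k)" using cop by (rule cong_mult_lcancel_nat)
    finally show ?thesis by (simp add: cong_def)
  qed
  have "F i \<in> S" for i by (simp add: F_def turn_mem b)
  moreover have "dist (F i) (F (Suc i)) = diameter S" for i
  proof -
    have "F (Suc i) = turn (j' * i) (turn j' b)"
      by (simp add: F_def turn_turn add.commute)
    then show ?thesis using b by (simp add: F_def dist_turn_turn j')
  qed
  ultimately have "(F i, F (Suc i)) \<in> parcs (diameter_graph S)" for i
    by (intro diameter_graph_arc)
  then have cyc: "cyclic_walk (parcs (diameter_graph S)) k F"
    using F_eq by (simp add: cyclic_walk_def k_def)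
  have "range F = F ` {..<k}"
  proof -
    have "F i = F (i mod k)" for i by (simp add: F_eq)
    moreover have "i mod k \<in> {..<k}" for i by (simp add: k_def)
    ultimately have "F i \<in> F ` {..<k}" for i by (metis imageI)
    then show ?thesis by auto
  qed
  moreover have "inj_on F {..<k}" by (auto simp: inj_on_def F_eq)
  ultimately have card: "card (range F) = k" by (simp add: card_image)
  have "\<exists>H. topological_wheel_graph (Suc (card (range F))) H \<and>
      subgraph (with_proj H) (with_proj (diameter_graph S))"
  proof (rule topological_wheel_in_graph[OF pair_bidirected_diameter_graph cyc])
    show "h \<notin> range F" using hF diameter by (metis dist_self less_irrefl rangeE)
    show "(h, x) \<in> parcs (diameter_graph S)" if "x \<in> range F" for x
      using that hF b by (auto simp: F_def intro!: diameter_graph_arc h(1) turn_mem)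
    show "card (range F) \<ge> 3" using card m by (simp add: k_def)
  qed simp
  then show ?thesis by (simp add: card k_def)
qed

text \<open>
  When \<open>b\<close> and \<open>c\<close> are in different orbits, the images of the triangle are disjoint except for the
  common vertex \<open>h\<close>. An odd cycle that avoids \<open>h\<close> meets each of them, hence passes through one
  neighbour of \<open>h\<close> for each of the \<open>2 * m + 1\<close> rotations.
\<close>

lemma wheel_of_odd_cycle:
  assumes h: "h \<in> S" "axis_dist h = 0" "dist h b = diameter S" "dist h c = diameter S"
    and bc: "b \<in> S" "c \<in> S" "dist b c = diameter S"
      "axis_dist b \<noteq> 0" "axis_dist c \<noteq> 0" "\<And>j. c \<noteq> turn j b"
    and cyc: "cyclic_walk (parcs (diameter_graph S)) n F" "odd n" "h \<notin> range F"
  shows "\<exists>H. topological_wheel_graph (2 * m + 2) H \<and>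
             subgraph (with_proj H) (with_proj (diameter_graph S))"
proof -
  define k where "k = 2 * m + 1"
  have step: "(F j, F (Suc j)) \<in> parcs (diameter_graph S)" for j 
    using cyc by (simp add: cyclic_walk_def)
  then have F: "F j \<in> S" "dist (F j) (F (Suc j)) = diameter S" for j
    by (auto simp: diameter_graph_def)
  have turn_h: "turn j h = h" for j using h by (simp add: turn_on_axis)
  have spoke: "dist h (turn j b) = diameter S" "dist h (turn j c) = diameter S" for j
    using dist_turn_turn[of j h b] dist_turn_turn[of j h c] h by (simp_all add: turn_h)
  have "\<exists>i. F i \<in> {h, turn j b, turn j c}" for j
  proof (rule triangle_meets_odd_closed_walk[where d = "diameter S" and S = S and N = n])
    show "F (i + n) = F i" for i using cyc cyclic_walk_shift by metis
  qed (use h bc spoke F cyc diameter dist_le_diameter in \<open>auto simp: turn_mem dist_turn_turn\<close>)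
  then have "\<exists>x. x \<in> range F \<and> x \<in> {turn j b, turn j c}" for j
    using cyc(3) by (metis insert_iff rangeI)
  then obtain f where f: "\<And>j. f j \<in> range F" "\<And>j. f j \<in> {turn j b, turn j c}"
    by metis
  have "turn i b \<noteq> turn j c" if "i < k" "j < k" for i j
  proof
    assume "turn i b = turn j c"
    then have "turn (k - j) (turn i b) = turn (k - j) (turn j c)" by simp
    also have "\<dots> = turn k c" using that by (simp add: turn_turn)
    also have "\<dots> = c" using turn_mod[of k c] by (simp add: k_def turn_0)
    finally show False using bc(6) by (metis turn_turn)
  qed
  then have "inj_on f {..<k}"
  proof (intro inj_onI)
    fix i j assume ij: "i \<in> {..<k}" "j \<in> {..<k}" "f i = f j"
      and disj: "\<And>i j. i < k \<Longrightarrow> j < k \<Longrightarrow> turn i b \<noteq> turn j c"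
    then have "turn i b = turn j b \<or> turn i c = turn j c"
      using f(2)[of i] f(2)[of j] by (metis insertE lessThan_iff singletonD)
    then have "i mod k = j mod k"
      using turn_eq_iff[OF bc(4)] turn_eq_iff[OF bc(5)] unfolding k_def by metis
    then show "i = j" using ij by simp
  qed
  then have card: "card (f ` {..<k}) = k" by (simp add: card_image)
  have "\<exists>H. topological_wheel_graph (Suc (card (f ` {..<k}))) H \<and>
      subgraph (with_proj H) (with_proj (diameter_graph S))"
  proof (rule topological_wheel_in_graph[OF pair_bidirected_diameter_graph cyc(1,3)])
    show "f ` {..<k} \<subseteq> range F" using f by blast
    show "(h, x) \<in> parcs (diameter_graph S)" if x: "x \<in> f ` {..<k}" for x
    proof -
      obtain j where "x = f j" using x by blast
      then have "x \<in> {turn j b, turn j c}" using f(2) by simp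
      then have "x \<in> S" "dist h x = diameter S" using spoke bc turn_mem by auto
      then show ?thesis by (intro diameter_graph_arc h(1))
    qed
    show "card (f ` {..<k}) \<ge> 3" using card m by (simp add: k_def)
  qed
  then show ?thesis unfolding card by (simp add: k_def)
qed

text \<open>
  If deleting \<open>h\<close> left a bipartite graph, the Borsuk number would be at most 3. So there is an odd
  cycle that avoids \<open>h\<close>, as the case of different orbits requires.
\<close>

lemma wheel_of_axial_triangle:
  assumes S: "finite S" "borsuk_number S = 4"
    and T: "h \<in> S" "b \<in> S" "c \<in> S" "axis_dist h = 0"
      "dist h b = diameter S" "dist h c = diameter S" "dist b c = diameter S"
  shows "\<exists>H. topological_wheel_graph (2 * m + 2) H \<and>
             subgraph (with_proj H) (with_proj (diameter_graph S))"
proof -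
  have off: "axis_dist b \<noteq> 0" "axis_dist c \<noteq> 0"
    using T triangle_meets_axis_once[of h b c] triangle_meets_axis_once[of h c b]
    by (auto simp: dist_commute)
  show ?thesis
  proof (cases "\<exists>j. c = turn j b")
    case True
    then show ?thesis using T off wheel_of_diagonals by metis
  next
    case False
    define R where "R = {(x, y) \<in> parcs (diameter_graph S). x \<noteq> h \<and> y \<noteq> h}"
    have "sym R" by (auto simp: R_def diameter_graph_def dist_commute intro!: symI)
    then show ?thesis
    proof (cases rule: odd_cycle_or_two_colouring)
      case (cycle n F)
      have "cyclic_walk (parcs (diameter_graph S)) n F" "h \<notin> range F"
        using cycle(2) by (auto simp: cyclic_walk_def R_def)
      then show ?thesis
        using T off False cycle(1) by (intro wheel_of_odd_cycle[of h b c n F]) auto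
    next
      case (colouring A)
      have "borsuk_number S \<le> 3"
      proof (rule borsuk_number_le_3[OF S(1) diameter])
        fix x y assume "x \<in> S - {h}" "y \<in> S - {h}" "dist x y = diameter S"
        moreover from this have "x \<noteq> y" using diameter by auto
        ultimately show "x \<in> A \<longleftrightarrow> y \<notin> A"
          using colouring by (simp add: R_def diameter_graph_def)
      qed
      then show ?thesis using S(2) by simp
    qed
  qed
qed

end

theorem theorem9:
  fixes S :: "(real^3) set" and m :: nat and D :: "(real^3 \<Rightarrow> real^3) set"
  assumes "finite S"
    and "m \<ge> 2"
    and "dihedral_group (2 * m + 1) D"
    and "D \<subseteq> Sym S"
    and "borsuk_number S = 4"
    and "girth (with_proj (diameter_graph S)) = 3"
  shows "\<exists>H. topological_wheel_graph (2 * m + 2) H \<and>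
             subgraph (with_proj H) (with_proj (diameter_graph S))"
proof -
  obtain p u v w where frame: "orthonormal_frame u v w"
    and rotations: "{axis_rotation p u v w (2 * pi * real j / real (2 * m + 1)) | j. j < 2 * m + 1} \<subseteq> D"
    using assms(3) unfolding dihedral_group_def by blast
  interpret axis p u v w by unfold_locales (rule frame)
  have invariant: "rotation (2 * pi * real j / real (2 * m + 1)) x \<in> S" if "x \<in> S" for j x
  proof -
    have "j mod (2 * m + 1) < 2 * m + 1" by simp
    then have "rotation (2 * pi * real (j mod (2 * m + 1)) / real (2 * m + 1)) \<in> Sym S"
      using rotations assms(4) by blast
    then have "rotation (2 * pi * real (j mod (2 * m + 1)) / real (2 * m + 1)) x \<in> S"
      using that unfolding Sym_def by blast
    moreover have "2 * m + 1 > 0" by simp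
    ultimately show ?thesis by (metis axis_rotation_mod)
  qed
  obtain a b c where "(a, b) \<in> parcs (diameter_graph S)" "(b, c) \<in> parcs (diameter_graph S)"
    "(c, a) \<in> parcs (diameter_graph S)"
    using girth_3_imp_triangle[OF assms(6)] .
  then have T: "a \<in> S" "b \<in> S" "c \<in> S" "a \<noteq> b"
    "dist a b = diameter S" "dist a c = diameter S" "dist b c = diameter S"
    by (auto simp: diameter_graph_def dist_commute)
  then have pos: "diameter S > 0" by (metis zero_less_dist_iff)
  interpret rotation_symmetric_set p u v w m S
    using assms(2) invariant pos finite_imp_bounded[OF assms(1)] by unfold_locales
  note wheel = wheel_of_axial_triangle[OF assms(1,5)]
  consider "axis_dist a = 0" | "axis_dist b = 0" | "axis_dist c = 0"
    using triangle_meets_axis T by blast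
  then show ?thesis
    by cases (use T wheel[of a b c] wheel[of b a c] wheel[of c a b] in \<open>auto simp: dist_commute\<close>)
qed

end
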